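(* Let $X$ be a Tychonoff space, let $E$ be an Urysohn sublattice of $C(X)$, and let $U\subset X$ be an open neighborhood of a compact $K\subset X$. Then for every $f\in E_+$ there is $e\in E$ with $0\le e\le f$ which coincides with $f$ on $K$ and vanishes outside of $U$; there is also $e'\in E$ with $0\le e'\le f$ which vanishes on $K$ and coincides with $f$ outside of $U$.
   Context: $C(X)$ is the vector lattice of all continuous real-valued functions on $X$ with pointwise operations. A sublattice is a linear subspace closed under the lattice operations. $E_+=\{f\in E:f\ge0\}$. A sublattice $E\subset C(X)$ is Urysohn if for every $x\in X$ and every open neighborhood $U$ of $x$ there is $f\in E$ with $f(x)=1$ and $f=0$ on $X\setminus U$. *)

theory Defs
  imports "HOL-Analysis.Analysis"
begin

text \<open>The library's \<^const>\<open>completely_regular_space\<close> does not include any separation of points.\<close>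

definition tychonoff_space :: "'a topology \<Rightarrow> bool" where
  "tychonoff_space X \<longleftrightarrow> completely_regular_space X \<and> Hausdorff_space X"

text \<open>Real functions on the carrier of \<open>X\<close> are encoded as total functions that are 0 off
  the carrier. This gives each function on the carrier exactly one representative, and is preserved
  by the pointwise linear and lattice operations of the type \<^typ>\<open>'a \<Rightarrow> real\<close>.\<close>

definition cont_funs :: "'a topology \<Rightarrow> ('a \<Rightarrow> real) set" where
  "cont_funs X = {f. continuous_map X euclideanreal f \<and> (\<forall>x. x \<notin> topspace X \<longrightarrow> f x = 0)}"

definition sublattice_of_C :: "'a topology \<Rightarrow> ('a \<Rightarrow> real) set \<Rightarrow> bool" where
  "sublattice_of_C X E \<longleftrightarrow>
     E \<subseteq> cont_funs X \<and>
     (\<lambda>x. 0) \<in> E \<and>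
     (\<forall>f\<in>E. \<forall>g\<in>E. (\<lambda>x. f x + g x) \<in> E) \<and>
     (\<forall>c. \<forall>f\<in>E. (\<lambda>x. c * f x) \<in> E) \<and>
     (\<forall>f\<in>E. \<forall>g\<in>E. sup f g \<in> E) \<and>
     (\<forall>f\<in>E. \<forall>g\<in>E. inf f g \<in> E)"

definition urysohn :: "'a topology \<Rightarrow> ('a \<Rightarrow> real) set \<Rightarrow> bool" where
  "urysohn X E \<longleftrightarrow>
     (\<forall>x U. openin X U \<and> x \<in> U \<longrightarrow>
        (\<exists>f\<in>E. f x = 1 \<and> (\<forall>y\<in>topspace X - U. f y = 0)))"

definition positive_cone :: "'a topology \<Rightarrow> ('a \<Rightarrow> real) set \<Rightarrow> ('a \<Rightarrow> real) set" where
  "positive_cone X E = {f \<in> E. \<forall>x\<in>topspace X. 0 \<le> f x}"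

end

theory Submission
  imports Defs
begin

text \<open>
  Only one function has to be constructed: some \<open>h \<in> E\<close> with \<open>h \<ge> 0\<close>, \<open>h = 0\<close> off \<open>U\<close> and
  \<open>h \<ge> f\<close> on \<open>K\<close>. Then \<open>e = f \<sqinter> h\<close> lies between \<open>0\<close> and \<open>f\<close>, agrees with \<open>f\<close> on \<open>K\<close> and
  vanishes off \<open>U\<close>, and \<open>e' = f - e\<close> is the second function sought.

  Near a point \<open>x \<in> U\<close> such an \<open>h\<close> comes from the Urysohn property: a function of \<open>E\<close> that vanishes
  off \<open>U\<close> can be scaled to exceed \<open>f\<close> at \<open>x\<close>, hence by continuity on a neighborhood of \<open>x\<close>
  (\<open>urysohn_local_majorant\<close>). Suprema of finitely many of these majorants stay in \<open>E\<close>, so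
  compactness of \<open>K\<close> passes from points to \<open>K\<close> (\<open>urysohn_compact_majorant\<close>).
\<close>

lemma sublattice_of_C_continuous:
  assumes "sublattice_of_C X E" "f \<in> E"
  shows "continuous_map X euclideanreal f"
  using assms by (auto simp: sublattice_of_C_def cont_funs_def)

lemma sublattice_of_C_diff:
  assumes "sublattice_of_C X E" "f \<in> E" "g \<in> E"
  shows "(\<lambda>x. f x - g x) \<in> E"
proof -
  have add: "\<forall>u\<in>E. \<forall>v\<in>E. (\<lambda>x. u x + v x) \<in> E"
    and scale: "\<forall>c. \<forall>u\<in>E. (\<lambda>x. c * u x) \<in> E"
    using assms(1) by (simp_all add: sublattice_of_C_def)
  have "(\<lambda>x. f x + (- 1) * g x) \<in> E"
    by (rule add[rule_format, OF assms(2) scale[rule_format, OF assms(3)]])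
  then show ?thesis by simp
qed

text \<open>
  The majorant is the positive part of \<open>(\<bar>f x\<bar> + 1) g\<close>, where \<open>g \<in> E\<close> equals \<open>1\<close> at \<open>x\<close> and
  vanishes off \<open>U\<close>. The summand \<open>1\<close> makes the inequality strict at \<open>x\<close>, so that it holds on an
  open set.
\<close>

lemma urysohn_local_majorant:
  assumes E: "sublattice_of_C X E" and "urysohn X E" and f: "f \<in> E"
    and U: "openin X U" "x \<in> U"
  obtains V h where "openin X V" "x \<in> V" "h \<in> E" "\<forall>y. 0 \<le> h y"
    "\<forall>y\<in>topspace X - U. h y = 0" "\<forall>y\<in>V. f y \<le> h y"
proof -
  have "\<exists>g\<in>E. g x = 1 \<and> (\<forall>y\<in>topspace X - U. g y = 0)"
    using assms(2) U by (simp add: urysohn_def)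
  then obtain g where g: "g \<in> E" "g x = 1" "\<forall>y\<in>topspace X - U. g y = 0"
    by (elim bexE conjE)
  define h where "h = sup (\<lambda>y. (\<bar>f x\<bar> + 1) * g y) (\<lambda>y. 0)"
  have h_eq: "h y = max ((\<bar>f x\<bar> + 1) * g y) 0" for y
    by (simp add: h_def sup_max)
  have "h \<in> E"
    using E g(1) by (simp add: h_def sublattice_of_C_def)
  define V where "V = {y \<in> topspace X. h y - f y \<in> {0<..}}"
  have "openin X V"
    unfolding V_def
    by (intro openin_continuous_map_preimage[where Y = euclideanreal] continuous_map_diff
        sublattice_of_C_continuous[OF E] \<open>h \<in> E\<close> f) auto
  then show ?thesis
  proof
    show "x \<in> V"
      using openin_subset[OF U(1)] U(2) g(2) by (auto simp: V_def h_eq)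
    show "h \<in> E" by fact
    show "\<forall>y. 0 \<le> h y" "\<forall>y\<in>topspace X - U. h y = 0"
      using g(3) by (simp_all add: h_eq)
    show "\<forall>y\<in>V. f y \<le> h y"
      by (simp add: V_def)
  qed
qed

text \<open>
  The open sets that admit a majorant vanishing off \<open>U\<close> form a family that covers \<open>K\<close> and is closed
  under finite unions, so compactness places \<open>K\<close> inside a single member.
\<close>

lemma urysohn_compact_majorant:
  assumes E: "sublattice_of_C X E" and "urysohn X E" and f: "f \<in> E"
    and "openin X U" and K: "compactin X K" and "K \<subseteq> U"
  obtains h where "h \<in> E" "\<forall>y. 0 \<le> h y"
    "\<forall>y\<in>topspace X - U. h y = 0" "\<forall>y\<in>K. f y \<le> h y"
proof -
  define P where "P V \<longleftrightarrow> (\<exists>h\<in>E. (\<forall>y. 0 \<le> h y) \<and> (\<forall>y\<in>topspace X - U. h y = 0) \<and>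
    (\<forall>y\<in>V. f y \<le> h y))" for V
  have "K \<subseteq> \<Union>{V. openin X V \<and> P V}"
  proof
    fix x assume "x \<in> K"
    with \<open>K \<subseteq> U\<close> have "x \<in> U" by blast
    obtain V h where "openin X V" "x \<in> V" "h \<in> E" "\<forall>y. 0 \<le> h y"
      "\<forall>y\<in>topspace X - U. h y = 0" "\<forall>y\<in>V. f y \<le> h y"
      by (rule urysohn_local_majorant[OF E assms(2) f \<open>openin X U\<close> \<open>x \<in> U\<close>])
    then show "x \<in> \<Union>{V. openin X V \<and> P V}"
      unfolding P_def by blast
  qed
  then obtain \<F> where "finite \<F>" "\<F> \<subseteq> {V. openin X V \<and> P V}" "K \<subseteq> \<Union>\<F>"
    using compactinD[OF K, of "{V. openin X V \<and> P V}"] by blast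
  from this(1,2) have "P (\<Union>\<F>)"
  proof (induction \<F> rule: finite_induct)
    case empty
    have "(\<lambda>x. 0) \<in> E" using E by (simp add: sublattice_of_C_def)
    then show ?case unfolding P_def by auto
  next
    case (insert V \<F>)
    then have "P V" "P (\<Union>\<F>)" by auto
    obtain g where
      g: "g \<in> E" "\<forall>y. 0 \<le> g y" "\<forall>y\<in>topspace X - U. g y = 0" "\<forall>y\<in>V. f y \<le> g y"
      using \<open>P V\<close> unfolding P_def by (elim bexE conjE)
    obtain h where
      h: "h \<in> E" "\<forall>y. 0 \<le> h y" "\<forall>y\<in>topspace X - U. h y = 0" "\<forall>y\<in>\<Union>\<F>. f y \<le> h y"
      using \<open>P (\<Union>\<F>)\<close> unfolding P_def by (elim bexE conjE)
    have "sup g h \<in> E"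
      using E g(1) h(1) by (simp add: sublattice_of_C_def)
    moreover have "\<forall>y. 0 \<le> sup g h y"
      using g(2) by (simp add: le_supI1)
    moreover have "\<forall>y\<in>topspace X - U. sup g h y = 0"
      using g(3) h(3) by simp
    moreover have "\<forall>y\<in>\<Union>(insert V \<F>). f y \<le> sup g h y"
      using g(4) h(4) by (auto intro: le_supI1 le_supI2)
    ultimately show ?case unfolding P_def by (intro bexI[of _ "sup g h"] conjI)
  qed
  then obtain h where "h \<in> E" "\<forall>y. 0 \<le> h y" "\<forall>y\<in>topspace X - U. h y = 0"
    "\<forall>y\<in>\<Union>\<F>. f y \<le> h y"
    unfolding P_def by (elim bexE conjE)
  with \<open>K \<subseteq> \<Union>\<F>\<close> show ?thesis
    by (intro that[of h]) auto
qed

theorem mainTheorem13: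
  fixes X :: "'a topology" and E :: "('a \<Rightarrow> real) set" and U K :: "'a set"
  assumes "tychonoff_space X"
    and "sublattice_of_C X E"
    and "urysohn X E"
    and "compactin X K"
    and "openin X U"
    and "K \<subseteq> U"
  shows "\<forall>f\<in>positive_cone X E.
     (\<exists>e\<in>E. (\<forall>x\<in>topspace X. 0 \<le> e x \<and> e x \<le> f x) \<and>
            (\<forall>x\<in>K. e x = f x) \<and>
            (\<forall>x\<in>topspace X - U. e x = 0)) \<and>
     (\<exists>e'\<in>E. (\<forall>x\<in>topspace X. 0 \<le> e' x \<and> e' x \<le> f x) \<and>
            (\<forall>x\<in>K. e' x = 0) \<and>
            (\<forall>x\<in>topspace X - U. e' x = f x))"
proof
  fix f assume "f \<in> positive_cone X E"
  then have f: "f \<in> E" and f0: "\<And>x. x \<in> topspace X \<Longrightarrow> 0 \<le> f x"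
    by (auto simp: positive_cone_def)
  obtain h where h: "h \<in> E" "\<forall>y. 0 \<le> h y" "\<forall>y\<in>topspace X - U. h y = 0"
    "\<forall>y\<in>K. f y \<le> h y"
    by (rule urysohn_compact_majorant[OF assms(2,3) f assms(5,4,6)])
  define e where "e = inf f h"
  have "e \<in> E"
    using assms(2) f h(1) by (simp add: e_def sublattice_of_C_def)
  have between: "\<forall>x\<in>topspace X. 0 \<le> e x \<and> e x \<le> f x"
    using f0 h(2) by (simp add: e_def)
  have on_K: "\<forall>x\<in>K. e x = f x"
    using h(4) by (simp add: e_def inf_absorb1)
  have off_U: "\<forall>x\<in>topspace X - U. e x = 0"
    using f0 h(3) by (simp add: e_def inf_absorb2)
  show "(\<exists>e\<in>E. (\<forall>x\<in>topspace X. 0 \<le> e x \<and> e x \<le> f x) \<and>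
            (\<forall>x\<in>K. e x = f x) \<and>
            (\<forall>x\<in>topspace X - U. e x = 0)) \<and>
     (\<exists>e'\<in>E. (\<forall>x\<in>topspace X. 0 \<le> e' x \<and> e' x \<le> f x) \<and>
            (\<forall>x\<in>K. e' x = 0) \<and>
            (\<forall>x\<in>topspace X - U. e' x = f x))"
  proof (intro conjI)
    show "\<exists>e\<in>E. (\<forall>x\<in>topspace X. 0 \<le> e x \<and> e x \<le> f x) \<and>
        (\<forall>x\<in>K. e x = f x) \<and> (\<forall>x\<in>topspace X - U. e x = 0)"
      using \<open>e \<in> E\<close> between on_K off_U by blast
    show "\<exists>e'\<in>E. (\<forall>x\<in>topspace X. 0 \<le> e' x \<and> e' x \<le> f x) \<and>
        (\<forall>x\<in>K. e' x = 0) \<and> (\<forall>x\<in>topspace X - U. e' x = f x)"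
      using between on_K off_U
      by (intro bexI[OF _ sublattice_of_C_diff[OF assms(2) f \<open>e \<in> E\<close>]]) auto
  qed
qed

end
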